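(* Let $n=2k$ with $k\geq 4$ an integer. Then the vertex-forwarding index of the complement of the circulant graph $C_n(1,k)$ is $$\xi(\overline{C_n(1,k)})=3.$$
   Context: For $S\subseteq\mathbb{Z}_n\setminus\{0\}$, the circulant graph $C_n(S)$ is the simple undirected graph with vertex set $\mathbb{Z}_n=\{0,1,\ldots,n-1\}$ and edge set $\{\{g,g+s\}: g\in\mathbb{Z}_n, s\in S\}$ (addition mod $n$); $C_n(1,k)$ means $C_n(\{1,k\})$. $\overline{\Gamma}$ denotes the complement of $\Gamma$. A routing $R$ of a connected graph $\Gamma$ on $n$ vertices is a set of $n(n-1)$ elementary (i.e. simple) paths $R(x,y)$, one from $x$ to $y$ for every ordered pair $(x,y)$ of distinct vertices. The load $\xi_x(\Gamma,R)$ of a vertex $x$ is the number of paths of $R$ having $x$ as an inner (non-end) vertex. Put $\xi(\Gamma,R)=\max_{x\in V(\Gamma)}\xi_x(\Gamma,R)$. The vertex-forwarding index is $\xi(\Gamma)=\min_R \xi(\Gamma,R)$, the minimum over all routings $R$ of $\Gamma$. *)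

theory Defs
  imports "Graph_Theory.Graph_Theory"
begin

text \<open>A simple undirected graph is represented as a symmetric loop-free pair digraph
  (locale \<open>pair_graph\<close>): the edge \<open>{u, v}\<close> is the pair of arcs \<open>(u, v)\<close>, \<open>(v, u)\<close>.\<close>

text \<open>Intended for \<open>S \<subseteq> {1..<n}\<close>, the nonzero elements of \<open>\<int>\<^sub>n = {0..<n}\<close>;
  an element of \<open>S\<close> divisible by \<open>n\<close> would produce loops.\<close>

definition circulant :: "nat \<Rightarrow> nat set \<Rightarrow> nat pair_pre_digraph" where
  "circulant n S = \<lparr> pverts = {0..<n},
     parcs = {(u, v). \<exists>g\<in>{0..<n}. \<exists>s\<in>S. {u, v} = {g, (g + s) mod n}} \<rparr>"

definition graph_complement :: "'a pair_pre_digraph \<Rightarrow> 'a pair_pre_digraph" where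
  "graph_complement G = \<lparr> pverts = pverts G,
     parcs = {(u, v). u \<in> pverts G \<and> v \<in> pverts G \<and> u \<noteq> v \<and> (u, v) \<notin> parcs G} \<rparr>"

text \<open>An elementary path from \<open>x\<close> to \<open>y\<close> is the list of its successive vertices; hence the
  paths from \<open>x\<close> to \<open>y\<close> and from \<open>y\<close> to \<open>x\<close> in a routing are different elements of it, even if
  they run through the same vertices.\<close>

definition routing :: "'a pair_pre_digraph \<Rightarrow> 'a list set \<Rightarrow> bool" where
  "routing G R \<longleftrightarrow>
     (\<forall>p\<in>R. vpath p (with_proj G) \<and> hd p \<noteq> last p) \<and>
     (\<forall>x\<in>pverts G. \<forall>y\<in>pverts G. x \<noteq> y \<longrightarrow> (\<exists>!p. p \<in> R \<and> hd p = x \<and> last p = y))"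

definition vertex_load :: "'a list set \<Rightarrow> 'a \<Rightarrow> nat" where
  "vertex_load R x = card {p \<in> R. x \<in> set p - {hd p, last p}}"

definition routing_load :: "'a pair_pre_digraph \<Rightarrow> 'a list set \<Rightarrow> nat" where
  "routing_load G R = Max (vertex_load R ` pverts G)"

text \<open>Meaningful for finite, nonempty, connected graphs only: otherwise there may be no routing.\<close>

definition vertex_forwarding_index :: "'a pair_pre_digraph \<Rightarrow> nat" where
  "vertex_forwarding_index G = Min {routing_load G R | R. routing G R}"

lemma pair_graph_circulant:
  assumes "S \<subseteq> {1..<n}"
  shows "pair_graph (circulant n S)"
proof -
  have neq: "g \<noteq> (g + s) mod n" if "g < n" "s \<in> S" for g s
  proof (cases "g + s < n")
    case False
    then have "(g + s) mod n = g + s - n"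
      using that assms by (subst le_mod_geq) auto
    then show ?thesis using False that assms by auto
  qed (use that assms in auto)
  have pv: "pverts (circulant n S) = {0..<n}"
    by (simp add: circulant_def)
  have sub: "parcs (circulant n S) \<subseteq> {0..<n} \<times> {0..<n}"
    by (auto simp: circulant_def doubleton_eq_iff)
  show ?thesis
  proof
    show "finite (parcs (circulant n S))" using sub finite_subset by blast
    show "symmetric (with_proj (circulant n S))"
      unfolding symmetric_def arcs_ends_def sym_def
      by (auto simp: circulant_def arc_to_ends_def insert_commute)
    show "fst e \<noteq> snd e" if "e \<in> parcs (circulant n S)" for e
      using that by (auto simp: circulant_def doubleton_eq_iff dest: neq neq[THEN not_sym])
  qed (use sub pv in auto)
qed

lemma pair_graph_complement:
  assumes "pair_graph G"
  shows "pair_graph (graph_complement G)"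
proof -
  interpret pair_graph G by fact
  have sub: "parcs (graph_complement G) \<subseteq> pverts G \<times> pverts G"
    by (auto simp: graph_complement_def)
  have sy: "(v, u) \<in> parcs G" if "(u, v) \<in> parcs G" for u v
    using that pair_sym_arcs by (auto simp: symmetric_def sym_def arcs_ends_def arc_to_ends_def)
  show ?thesis
  proof
    show "finite (parcs (graph_complement G))"
      using sub pair_finite_verts finite_subset by blast
    show "symmetric (with_proj (graph_complement G))"
      unfolding symmetric_def arcs_ends_def sym_def
      using sy by (auto simp: graph_complement_def arc_to_ends_def)
  qed (use pair_finite_verts in \<open>auto simp: graph_complement_def\<close>)
qed

lemma finite_routings:
  assumes "finite (pverts G)"
  shows "finite {R. routing G R}"
proof (rule finite_subset)
  show "{R. routing G R} \<subseteq> Pow {p. set p \<subseteq> pverts G \<and> distinct p}"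
    by (auto simp: routing_def vpath_def vwalk_def)
qed (use assms finite_subset_distinct in auto)

end

theory Submission
  imports Defs
begin

text \<open>
  In the complement of a graph \<open>H\<close>, the pairs that are not joined by an edge are the arcs of \<open>H\<close>.
  Each of them needs a path with at least one inner vertex, so the loads of any routing add up to
  at least the number of arcs of \<open>H\<close>. The circulant graph \<open>C\<^sub>2\<^sub>k(1, k)\<close> is 3-regular, since the
  differences \<open>k\<close> and \<open>-k\<close> coincide; it has \<open>3n\<close> arcs on \<open>n\<close> vertices, so that every routing of
  its complement puts load at least 3 on some vertex (\<open>nonadjacent_pairs_le_load\<close>, \<open>card_arcs_circulant\<close>).

  The bound is attained by a rotation-invariant routing. Adjacent vertices of the complement are
  joined by their edge, the remaining pairs by paths with a single inner vertex, namely
  \<open>x, x + 3, x + 1\<close> and \<open>x, x - 3, x - 1\<close> and \<open>x, x + 2, x + k\<close>. The steps that occur are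
  \<open>\<plusminus>3\<close>, \<open>\<plusminus>2\<close> and \<open>k - 2\<close>, and none of them is \<open>0\<close>, \<open>\<plusminus>1\<close> or \<open>k\<close> modulo \<open>2k\<close> as \<open>k \<ge> 4\<close>.
  Each of the three kinds of path passes through a given vertex exactly once, so all loads are at
  most 3.
\<close>

section \<open>Counting inner vertices\<close>

definition nonadjacent_pairs :: "'a pair_pre_digraph \<Rightarrow> ('a \<times> 'a) set" where
  "nonadjacent_pairs G =
     {(x, y). x \<in> pverts G \<and> y \<in> pverts G \<and> x \<noteq> y \<and> (x, y) \<notin> parcs G}"

lemma vpath_nonadjacent_inner_vertex:
  assumes "vpath p (with_proj G)" and "hd p \<noteq> last p" and "(hd p, last p) \<notin> parcs G"
  shows "\<exists>v\<in>pverts G. v \<in> set p - {hd p, last p}"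
proof -
  have p: "p \<noteq> []" "distinct p" "set p \<subseteq> pverts G" "set (vwalk_arcs p) \<subseteq> parcs G"
    using assms(1) by (auto simp: vpath_def vwalk_def)
  obtain a q where q: "p = a # q" using p(1) by (cases p) auto
  obtain b r where r: "q = b # r" using q assms(2) by (cases q) auto
  have "r \<noteq> []" using q r p(4) assms(3) by auto
  with p q r show ?thesis by (intro bexI[of _ b]) auto
qed

text \<open>Double counting: pairing each nonadjacent pair with an inner vertex of its path gives an
  injection into the incidences between paths and their inner vertices, since a path determines
  its ends.\<close>

lemma nonadjacent_pairs_le_load:
  assumes fin: "finite (pverts G)" and R: "routing G R"
  shows "card (nonadjacent_pairs G) \<le> card (pverts G) * routing_load G R"
proof -
  let ?through = "\<lambda>v. {p \<in> R. v \<in> set p - {hd p, last p}}"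
  have "R \<subseteq> {p. set p \<subseteq> pverts G \<and> distinct p}"
    using R by (auto simp: routing_def vpath_def vwalk_def)
  then have finR: "finite R"
    using finite_subset_distinct[OF fin] finite_subset by blast
  then have finI: "finite (Sigma (pverts G) ?through)"
    using fin by auto
  have "nonadjacent_pairs G \<subseteq> (\<lambda>(v, p). (hd p, last p)) ` Sigma (pverts G) ?through"
  proof
    fix e assume e: "e \<in> nonadjacent_pairs G"
    obtain x y where xy: "e = (x, y)" by (cases e)
    have V: "x \<in> pverts G" "y \<in> pverts G" "x \<noteq> y" "(x, y) \<notin> parcs G"
      using e xy by (auto simp: nonadjacent_pairs_def)
    obtain p where p: "p \<in> R" "hd p = x" "last p = y"
      using R V unfolding routing_def by blast
    have "vpath p (with_proj G)" using R p unfolding routing_def by blast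
    then obtain v where "v \<in> pverts G" "v \<in> set p - {hd p, last p}"
      using vpath_nonadjacent_inner_vertex V p by metis
    then show "e \<in> (\<lambda>(v, p). (hd p, last p)) ` Sigma (pverts G) ?through"
      using p xy by (intro image_eqI[of _ _ "(v, p)"]) auto
  qed
  then have "card (nonadjacent_pairs G) \<le> card (Sigma (pverts G) ?through)"
    using finI by (meson card_image_le card_mono finite_imageI le_trans)
  also have "\<dots> = (\<Sum>v\<in>pverts G. vertex_load R v)"
    using fin finR by (subst card_SigmaI) (auto simp: vertex_load_def)
  also have "\<dots> \<le> (\<Sum>v\<in>pverts G. routing_load G R)"
    unfolding routing_load_def using fin by (intro sum_mono Max_ge) auto
  finally show ?thesis by simp
qed

section \<open>Routings with at most one inner vertex per path\<close>

definition midpoint_path ::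
  "'a pair_pre_digraph \<Rightarrow> ('a \<Rightarrow> 'a \<Rightarrow> 'a) \<Rightarrow> 'a \<Rightarrow> 'a \<Rightarrow> 'a list" where
  "midpoint_path G m x y = (if (x, y) \<in> parcs G then [x, y] else [x, m x y, y])"

definition midpoint_routing :: "'a pair_pre_digraph \<Rightarrow> ('a \<Rightarrow> 'a \<Rightarrow> 'a) \<Rightarrow> 'a list set" where
  "midpoint_routing G m =
     {midpoint_path G m x y | x y. x \<in> pverts G \<and> y \<in> pverts G \<and> x \<noteq> y}"

lemma routing_midpoint_routing:
  assumes G: "pair_graph G"
    and m: "\<And>x y. (x, y) \<in> nonadjacent_pairs G \<Longrightarrow> (x, m x y) \<in> parcs G \<and> (m x y, y) \<in> parcs G"
  shows "routing G (midpoint_routing G m)"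
proof -
  interpret pair_graph G by fact
  have ends: "hd (midpoint_path G m x y) = x" "last (midpoint_path G m x y) = y" for x y
    by (auto simp: midpoint_path_def)
  have path: "vpath (midpoint_path G m x y) (with_proj G)"
    if xy: "x \<in> pverts G" "y \<in> pverts G" "x \<noteq> y" for x y
  proof (cases "(x, y) \<in> parcs G")
    case True
    then show ?thesis using xy by (auto simp: midpoint_path_def vpath_def vwalk_def)
  next
    case False
    with xy have mxy: "(x, m x y) \<in> parcs G" "(m x y, y) \<in> parcs G"
      using m by (auto simp: nonadjacent_pairs_def)
    then have "m x y \<in> pverts G" "x \<noteq> m x y" "m x y \<noteq> y"
      using in_arcsD1 no_loops by fastforce+
    then show ?thesis
      using xy mxy False by (auto simp: midpoint_path_def vpath_def vwalk_def)
  qed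
  have "\<exists>!p. p \<in> midpoint_routing G m \<and> hd p = x \<and> last p = y"
    if "x \<in> pverts G" "y \<in> pverts G" "x \<noteq> y" for x y
    using that by (intro ex1I[of _ "midpoint_path G m x y"])
      (auto simp: midpoint_routing_def ends)
  then show ?thesis
    unfolding routing_def using path by (auto simp: midpoint_routing_def ends)
qed

text \<open>The paths that consist of a single edge have no inner vertex, so only nonadjacent pairs
  contribute.\<close>

lemma vertex_load_midpoint_routing:
  assumes "finite (pverts G)"
  shows "vertex_load (midpoint_routing G m) v \<le>
    card {(x, y) \<in> nonadjacent_pairs G. m x y = v}"
proof -
  let ?E = "{(x, y) \<in> nonadjacent_pairs G. m x y = v}"
  have "?E \<subseteq> pverts G \<times> pverts G" by (auto simp: nonadjacent_pairs_def)
  then have fin: "finite ?E" using assms by (meson finite_SigmaI finite_subset)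
  have "{p \<in> midpoint_routing G m. v \<in> set p - {hd p, last p}}
      \<subseteq> (\<lambda>(x, y). midpoint_path G m x y) ` ?E"
    by (force simp: midpoint_routing_def midpoint_path_def nonadjacent_pairs_def
        split: if_splits)
  then show ?thesis
    unfolding vertex_load_def using fin by (meson card_image_le card_mono finite_imageI le_trans)
qed

section \<open>The circulant graph with differences 1 and k\<close>

lemma nonadjacent_pairs_complement:
  assumes "pair_graph H"
  shows "nonadjacent_pairs (graph_complement H) = parcs H"
proof -
  interpret pair_graph H by fact
  show ?thesis
    using in_arcsD1 in_arcsD2 no_loops
    by (fastforce simp: nonadjacent_pairs_def graph_complement_def)
qed

lemma add_mod_if:
  fixes x c n :: nat
  assumes "x < n" and "c < n"
  shows "(x + c) mod n = (if x + c < n then x + c else x + c - n)"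
  using assms by (simp add: le_mod_geq)

lemma add_mod_left_cancel:
  fixes x c d n :: nat
  assumes "x < n" and "c < n" and "d < n" and "(x + c) mod n = (x + d) mod n"
  shows "c = d"
  using assms by (auto simp: add_mod_if split: if_splits)

text \<open>The third difference is \<open>n - 1\<close>, which stands for \<open>-1\<close>; the difference \<open>-k\<close> is \<open>k\<close>.\<close>

lemma arcs_circulant:
  fixes n k :: nat
  assumes "n = 2 * k" and "k \<ge> 2"
  shows "parcs (circulant n {1, k}) =
    {(x, y). x < n \<and> (y = (x + 1) mod n \<or> y = (x + k) mod n \<or> y = (x + (n - 1)) mod n)}"
proof -
  have arc: "(x, y) \<in> parcs (circulant n {1, k}) \<longleftrightarrow> x < n \<and> y < n \<and>
      (y = (x + 1) mod n \<or> x = (y + 1) mod n \<or> y = (x + k) mod n \<or> x = (y + k) mod n)" for x y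
    using assms by (auto simp: circulant_def doubleton_eq_iff)
  have rev_arc: "x = (y + c) mod n \<longleftrightarrow> y = (x + (n - c)) mod n"
    if "x < n" "y < n" "0 < c" "c < n" for x y c
    using that add_mod_if[of y n c] add_mod_if[of x n "n - c"] by auto
  have less: "z mod n < n" for z using assms by simp
  have "(x, y) \<in> parcs (circulant n {1, k}) \<longleftrightarrow>
      x < n \<and> (y = (x + 1) mod n \<or> y = (x + k) mod n \<or> y = (x + (n - 1)) mod n)" for x y
  proof (cases "x < n \<and> y < n")
    case True
    then show ?thesis using arc[of x y] rev_arc[of x y 1] rev_arc[of x y k] assms
      by (auto simp del: One_nat_def)
  next
    case False
    then show ?thesis using arc[of x y] less by blast
  qed
  then show ?thesis by blast
qed

lemma card_arcs_circulant:
  fixes n k :: nat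
  assumes "n = 2 * k" and "k \<ge> 2"
  shows "card (parcs (circulant n {1, k})) = 3 * n"
proof -
  have "{(x, y). x < n \<and> (y = f x a \<or> y = f x b \<or> y = f x c)} =
      (\<lambda>(x, c). (x, f x c)) ` ({0..<n} \<times> {a, b, c})" for f :: "nat \<Rightarrow> nat \<Rightarrow> nat" and a b c
    by (auto simp: image_iff)
  from this[of "\<lambda>x c. (x + c) mod n"] have "parcs (circulant n {1, k}) =
      (\<lambda>(x, c). (x, (x + c) mod n)) ` ({0..<n} \<times> {1, k, n - 1})"
    unfolding arcs_circulant[OF assms] by blast
  moreover have "inj_on (\<lambda>(x, c). (x, (x + c) mod n)) ({0..<n} \<times> {1, k, n - 1})"
  proof -
    have "c < n" if "c \<in> {1, k, n - 1}" for c using that assms by auto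
    then show ?thesis
      unfolding inj_on_def Ball_def split_paired_All mem_Times_iff fst_conv snd_conv case_prod_conv
        atLeastLessThan_iff prod.inject
      using add_mod_left_cancel by blast
  qed
  moreover have "card {1, k, n - 1} = 3" using assms by auto
  ultimately show ?thesis by (simp add: card_image card_cartesian_product)
qed

text \<open>The form in which the routing is checked: only the length of a step matters, not its
  starting point.\<close>

lemma complement_circulant_step:
  fixes n k :: nat
  assumes "n = 2 * k" and "k \<ge> 2"
    and "x < n" and "c < n" and "c \<notin> {0, 1, k, n - 1}"
  shows "(x, (x + c) mod n) \<in> parcs (graph_complement (circulant n {1, k}))"
proof -
  have ne: "(x + c) mod n \<noteq> (x + d) mod n" if "d \<in> {0, 1, k, n - 1}" for d
  proof
    have "d < n" using that assms(1,2) by auto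
    moreover assume "(x + c) mod n = (x + d) mod n"
    ultimately have "c = d" using assms(3,4) add_mod_left_cancel by blast
    then show False using that assms(5) by blast
  qed
  have "(x, (x + c) mod n) \<notin> parcs (circulant n {1, k})"
    using ne[of 1] ne[of k] ne[of "n - 1"] unfolding arcs_circulant[OF assms(1,2)] by blast
  moreover have "x \<noteq> (x + c) mod n" using ne[of 0] assms(3) by auto
  moreover have "pverts (circulant n {1, k}) = {0..<n}" by (simp add: circulant_def)
  ultimately show ?thesis using assms(3) by (simp add: graph_complement_def)
qed

text \<open>The displacement of the midpoint from \<open>x\<close> depends only on \<open>y - x\<close>, which makes the routing
  invariant under rotations and spreads the load evenly. The last case belongs to \<open>y = x - 1\<close>, and
  \<open>n - 3\<close> stands for \<open>-3\<close>.\<close>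

definition circulant_midpoint :: "nat \<Rightarrow> nat \<Rightarrow> nat \<Rightarrow> nat \<Rightarrow> nat" where
  "circulant_midpoint n k x y =
     (x + (if y = (x + 1) mod n then 3 else if y = (x + k) mod n then 2 else n - 3)) mod n"

lemma circulant_midpoint_cases:
  assumes "n = 2 * k" and "k \<ge> 4" and "(x, y) \<in> parcs (circulant n {1, k})"
  obtains "x < n" "y = (x + 1) mod n" "circulant_midpoint n k x y = (x + 3) mod n"
  | "x < n" "y = (x + k) mod n" "circulant_midpoint n k x y = (x + 2) mod n"
  | "x < n" "y = (x + (n - 1)) mod n" "circulant_midpoint n k x y = (x + (n - 3)) mod n"
proof -
  have "k \<ge> 2" using assms(2) by simp
  have x: "x < n"
    and y: "y = (x + 1) mod n \<or> y = (x + k) mod n \<or> y = (x + (n - 1)) mod n"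
    using assms(3) unfolding arcs_circulant[OF assms(1) \<open>k \<ge> 2\<close>] by auto
  have ne: "(x + c) mod n \<noteq> (x + d) mod n" if "c < n" "d < n" "c \<noteq> d" for c d
    using that x add_mod_left_cancel by blast
  have "(x + k) mod n \<noteq> (x + 1) mod n" "(x + (n - 1)) mod n \<noteq> (x + 1) mod n"
    "(x + (n - 1)) mod n \<noteq> (x + k) mod n"
    using ne[of k 1] ne[of "n - 1" 1] ne[of "n - 1" k] assms(1,2) by simp_all
  then have "y = (x + 1) mod n \<Longrightarrow> circulant_midpoint n k x y = (x + 3) mod n"
    "y = (x + k) mod n \<Longrightarrow> circulant_midpoint n k x y = (x + 2) mod n"
    "y = (x + (n - 1)) mod n \<Longrightarrow> circulant_midpoint n k x y = (x + (n - 3)) mod n"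
    unfolding circulant_midpoint_def by (simp_all only: if_True if_False simp_thms)
  with x y show ?thesis by (elim disjE) (use that in blast)+
qed

lemma circulant_midpoint_adjacent:
  assumes "n = 2 * k" and "k \<ge> 4" and "(x, y) \<in> parcs (circulant n {1, k})"
  shows "(x, circulant_midpoint n k x y) \<in> parcs (graph_complement (circulant n {1, k}))"
    and "(circulant_midpoint n k x y, y) \<in> parcs (graph_complement (circulant n {1, k}))"
proof -
  let ?G = "graph_complement (circulant n {1, k})"
  have "k \<ge> 2" using assms(2) by simp
  note step = complement_circulant_step[OF assms(1) this]
  show "(x, circulant_midpoint n k x y) \<in> parcs ?G"
    using assms
  proof (cases rule: circulant_midpoint_cases)
    case 1
    show ?thesis using step[OF 1(1), of 3] assms(1,2) unfolding 1(3) by simp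
  next
    case 2
    show ?thesis using step[OF 2(1), of 2] assms(1,2) unfolding 2(3) by simp
  next
    case 3
    have "n - 3 < n" "n - 3 \<notin> {0, 1, k, n - 1}" using assms(1,2) by auto
    then show ?thesis using step 3(1) unfolding 3(3) by blast
  qed
  have z: "circulant_midpoint n k x y < n"
    using assms by (auto simp: circulant_midpoint_def)
  \<comment> \<open>From the midpoint to \<open>y\<close> the steps are \<open>-2\<close>, \<open>k - 2\<close> and \<open>2\<close>.\<close>
  show "(circulant_midpoint n k x y, y) \<in> parcs ?G"
    using assms
  proof (cases rule: circulant_midpoint_cases)
    case 1
    have "((x + 3) mod n + (n - 2)) mod n = (x + 3 + (n - 2)) mod n" by (rule mod_add_left_eq)
    also have "x + 3 + (n - 2) = x + 1 + n" using assms(1,2) by simp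
    also have "(x + 1 + n) mod n = (x + 1) mod n" by (rule mod_add_self2)
    finally have "y = (circulant_midpoint n k x y + (n - 2)) mod n" using 1 by simp
    moreover have "n - 2 < n" "n - 2 \<notin> {0, 1, k, n - 1}" using assms(1,2) by auto
    ultimately show ?thesis using step[OF z] by metis
  next
    case 2
    have "((x + 2) mod n + (k - 2)) mod n = (x + 2 + (k - 2)) mod n" by (rule mod_add_left_eq)
    also have "x + 2 + (k - 2) = x + k" using assms(1,2) by simp
    finally have "y = (circulant_midpoint n k x y + (k - 2)) mod n" using 2 by simp
    moreover have "k - 2 < n" "k - 2 \<notin> {0, 1, k, n - 1}" using assms(1,2) by auto
    ultimately show ?thesis using step[OF z] by metis
  next
    case 3
    have "((x + (n - 3)) mod n + 2) mod n = (x + (n - 3) + 2) mod n"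
      by (rule mod_add_left_eq)
    also have "x + (n - 3) + 2 = x + (n - 1)" using assms(1,2) by simp
    finally have "y = (circulant_midpoint n k x y + 2) mod n" using 3 by simp
    moreover have "2 < n" "2 \<notin> {0, 1, k, n - 1}" using assms(1,2) by auto
    ultimately show ?thesis using step[OF z] by metis
  qed
qed

text \<open>For each of the three differences \<open>y - x\<close> the midpoint is a rotation of \<open>x\<close>, so it determines
  \<open>x\<close> and hence the pair.\<close>

lemma card_circulant_midpoint_le:
  assumes "n = 2 * k" and "k \<ge> 4"
  shows "card {(x, y) \<in> parcs (circulant n {1, k}). circulant_midpoint n k x y = v} \<le> 3"
proof -
  define rot where "rot c = (v + c) mod n" for c
  let ?A = "{(rot (n - 3), (rot (n - 3) + 1) mod n), (rot (n - 2), (rot (n - 2) + k) mod n),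
    (rot 3, (rot 3 + (n - 1)) mod n)}"
  have rot: "x = rot (n - d)" if "x < n" "d < n" "0 < d" "v = (x + d) mod n" for x d
    using that unfolding rot_def by (auto simp: add_mod_if)
  have "(x, y) \<in> ?A"
    if e: "(x, y) \<in> parcs (circulant n {1, k})" and v: "circulant_midpoint n k x y = v" for x y
    using assms(1,2) e
  proof (cases rule: circulant_midpoint_cases)
    case 1
    then show ?thesis using rot[of x 3] v assms by simp
  next
    case 2
    then show ?thesis using rot[of x 2] v assms by simp
  next
    case 3
    then show ?thesis using rot[of x "n - 3"] v assms by simp
  qed
  then have "{(x, y) \<in> parcs (circulant n {1, k}). circulant_midpoint n k x y = v} \<subseteq> ?A"
    by blast
  then have "card {(x, y) \<in> parcs (circulant n {1, k}). circulant_midpoint n k x y = v} \<le> card ?A"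
    by (intro card_mono) auto
  also have "\<dots> \<le> 3" by (simp add: card_insert_if)
  finally show ?thesis .
qed

section \<open>The forwarding index\<close>

theorem corollary4p1:
  fixes n k :: nat
  assumes "n = 2 * k" and "k \<ge> 4"
  shows "vertex_forwarding_index (graph_complement (circulant n {1, k})) = 3"
proof -
  let ?H = "circulant n {1, k}"
  let ?G = "graph_complement ?H"
  have "n > 0" "k \<ge> 2" using assms by auto
  have H: "pair_graph ?H" using assms by (intro pair_graph_circulant) auto
  then have G: "pair_graph ?G" by (rule pair_graph_complement)
  have V: "pverts ?G = {0..<n}" by (simp add: graph_complement_def circulant_def)
  note nonadj = nonadjacent_pairs_complement[OF H]
  have lower: "3 \<le> routing_load ?G R" if "routing ?G R" for R
  proof -
    have "card (parcs ?H) \<le> card {0..<n} * routing_load ?G R"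
      using nonadjacent_pairs_le_load[OF _ that] unfolding V nonadj by blast
    then have "3 * n \<le> n * routing_load ?G R"
      unfolding card_arcs_circulant[OF assms(1) \<open>k \<ge> 2\<close>] by simp
    then show ?thesis using \<open>n > 0\<close> by simp
  qed
  let ?R = "midpoint_routing ?G (circulant_midpoint n k)"
  have R: "routing ?G ?R"
    using G by (rule routing_midpoint_routing)
      (use circulant_midpoint_adjacent[OF assms] in \<open>unfold nonadj, blast\<close>)
  have "vertex_load ?R v \<le> 3" for v
  proof -
    have "vertex_load ?R v \<le> card {(x, y) \<in> parcs ?H. circulant_midpoint n k x y = v}"
      using vertex_load_midpoint_routing[of ?G "circulant_midpoint n k" v]
      unfolding V nonadj by blast
    also have "\<dots> \<le> 3" using assms by (rule card_circulant_midpoint_le)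
    finally show ?thesis .
  qed
  then have "routing_load ?G ?R \<le> 3"
    unfolding routing_load_def V using \<open>n > 0\<close> by (subst Max_le_iff) auto
  with lower[OF R] have upper: "routing_load ?G ?R = 3" by simp
  have "finite {R. routing ?G R}" by (rule finite_routings) (unfold V, simp)
  then have "finite {routing_load ?G R | R. routing ?G R}"
    by (simp add: setcompr_eq_image)
  then show ?thesis
    unfolding vertex_forwarding_index_def
    by (rule Min_eqI) (use lower R upper[symmetric] in auto)
qed

end
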